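(* Let $3\le k\le n$ and let $m=(m_1,\dots,m_k)^{\mathsf T}\in\mathbb{N}^k$ with $m_i\ge1$ and $\sum_{i=1}^k m_i=n$. Let $x_i\in\mathbb{R}^n$, $X_i\in\mathbb{R}^{n\times n}$ symmetric ($i=1,\dots,k-1$) and $X_{ij}\in\mathbb{R}^{n\times n}$ with $X_{ji}=X_{ij}^{\mathsf T}$ ($i\ne j$, $i,j=1,\dots,k-1$) satisfy - $\mathrm{diag}(X_i)=x_i$ for $i=1,\dots,k-1$; - $\mathrm{diag}(X_{ij})=0$ for $i\neq j$, $i,j=1,\dots,k-1$; - $\mathrm{trace}(X_i)=m_i$ for $i=1,\dots,k-1$; - $\langle J_n,X_i\rangle=m_i^2$ for $i=1,\dots,k-1$; - $\langle J_n,X_{ij}+X_{ij}^{\mathsf T}\rangle=2m_im_j$ for $i\ne j$, $i,j=1,\dots,k-1$; - $\widetilde Z=\begin{bmatrix}X_1&X_{1,2}&\cdots&X_{1,k-1}&x_1\\ X_{1,2}^{\mathsf T}&X_2&\cdots&X_{2,k-1}&x_2\\ \vdots&\vdots&&\vdots&\vdots\\ X_{1,k-1}^{\mathsf T}&X_{2,k-1}^{\mathsf T}&\cdots&X_{k-1}&x_{k-1}\\ x_1^{\mathsf T}&x_2^{\mathsf T}&\cdots&x_{k-1}^{\mathsf T}&1\end{bmatrix}\succeq0.$ Define the missing blocks by $$x_k:=e_n-\sum_{i=1}^{k-1}x_i,\qquad X_{ik}:=x_ie_n^{\mathsf T}-X_i-\sum_{\substack{j=1\\ j\ne i}}^{k-1}X_{ij},\quad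 X_{ki}:=X_{ik}^{\mathsf T}\quad(i=1,\dots,k-1),\qquad X_k:=x_ke_n^{\mathsf T}-\sum_{j=1}^{k-1}X_{kj}.$$ Then - $\mathrm{diag}(X_i)=x_i$ for $i=1,\dots,k$; - $\mathrm{diag}(X_{ij})=0$ for $i\neq j$, $i,j=1,\dots,k$; - $\mathrm{trace}(X_i)=m_i$ for $i=1,\dots,k$; - $\langle J_n,X_i\rangle=m_i^2$ for $i=1,\dots,k$; - $\langle J_n,X_{ij}+X_{ij}^{\mathsf T}\rangle=2m_im_j$ for $i\ne j$, $i,j=1,\dots,k$; - $Z=\begin{bmatrix}X_1&X_{12}&\cdots&X_{1k}&x_1\\ X_{21}&X_2&\cdots&X_{2k}&x_2\\ \vdots&\vdots&&\vdots&\vdots\\ X_{k1}&X_{k2}&\cdots&X_k&x_k\\ x_1^{\mathsf T}&x_2^{\mathsf T}&\cdots&x_k^{\mathsf T}&1\end{bmatrix}\succeq0.$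
   Context: $e_n$ is the all-ones $n$-vector, $J_n=e_ne_n^{\mathsf T}$ the all-ones matrix, $\mathrm{diag}(M)$ the vector of diagonal entries of $M$, $\langle\cdot,\cdot\rangle$ the trace inner product, and $M\succeq0$ means that $M$ is symmetric positive semidefinite. The first list of constraints is the feasible region of the reduced SDP relaxation (matrix variable $\widetilde Z$ of order $n(k-1)+1$) of the minimal partition problem, and the second list is that of the full SDP relaxation (matrix variable $Z$ of order $nk+1$). *)

theory Defs
  imports "Jordan_Normal_Form.Matrix"
begin

definition ones_vec :: "nat \<Rightarrow> real vec" where
  "ones_vec n = vec n (\<lambda>_. 1)"

definition outer_prod :: "real vec \<Rightarrow> real vec \<Rightarrow> real mat" where
  "outer_prod u v = mat (dim_vec u) (dim_vec v) (\<lambda>(a, b). u $ a * v $ b)"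

definition ones_mat :: "nat \<Rightarrow> real mat" where
  "ones_mat n = outer_prod (ones_vec n) (ones_vec n)"

definition diag_vec :: "real mat \<Rightarrow> real vec" where
  "diag_vec A = vec (dim_row A) (\<lambda>a. A $$ (a, a))"

definition mat_trace :: "real mat \<Rightarrow> real" where
  "mat_trace A = (\<Sum>a<dim_row A. A $$ (a, a))"

definition trace_inner :: "real mat \<Rightarrow> real mat \<Rightarrow> real" where
  "trace_inner A B = mat_trace (transpose_mat A * B)"

definition sym_psd :: "real mat \<Rightarrow> bool" where
  "sym_psd M \<longleftrightarrow> square_mat M \<and> transpose_mat M = M \<and>
     (\<forall>v \<in> carrier_vec (dim_row M). 0 \<le> v \<bullet> (M *\<^sub>v v))"

(* Blocks are numbered from 1, while row and column indices of a matrix start at 0: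
   row r < p * n lies in block row r div n + 1, at position r mod n inside it.
   The diagonal blocks are the X i, the off-diagonal blocks the Y i j with i \<noteq> j
   (the values Y i i are never used). *)

definition block_part ::
  "nat \<Rightarrow> nat \<Rightarrow> (nat \<Rightarrow> real mat) \<Rightarrow> (nat \<Rightarrow> nat \<Rightarrow> real mat) \<Rightarrow> real mat" where
  "block_part p n X Y = mat (p * n) (p * n) (\<lambda>(r, c).
     let i = r div n + 1; j = c div n + 1
     in (if i = j then X i else Y i j) $$ (r mod n, c mod n))"

definition stacked_col :: "nat \<Rightarrow> nat \<Rightarrow> (nat \<Rightarrow> real vec) \<Rightarrow> real mat" where
  "stacked_col p n x = mat (p * n) 1 (\<lambda>(r, _). x (r div n + 1) $ (r mod n))"

definition bordered_block_mat ::
  "nat \<Rightarrow> nat \<Rightarrow> (nat \<Rightarrow> real vec) \<Rightarrow> (nat \<Rightarrow> real mat) \<Rightarrow> (nat \<Rightarrow> nat \<Rightarrow> real mat) \<Rightarrow> real mat"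
where
  "bordered_block_mat p n x X Y =
     four_block_mat (block_part p n X Y) (stacked_col p n x)
                    (transpose_mat (stacked_col p n x)) (1\<^sub>m 1)"

lemma bordered_block_mat_carrier:
  "bordered_block_mat p n x X Y \<in> carrier_mat (p * n + 1) (p * n + 1)"
  unfolding bordered_block_mat_def
  by (rule four_block_carrier_mat) (simp_all add: block_part_def stacked_col_def)

end

theory Submission
  imports Defs
begin

text \<open>
  The missing blocks are forced by \<open>x\<^sub>1 + \<dots> + x\<^sub>k = e\<close> and \<open>\<Sum>\<^sub>j X\<^sub>i\<^sub>j = x\<^sub>i e\<^sup>T\<close>, so their diagonals,
  traces and entry sums follow linearly from those of the given blocks. For positive
  semidefiniteness, these relations say that the full matrix is congruent to a smaller one,
  \<open>Z = V Z' V\<^sup>T\<close>, where \<open>V\<close> is the identity with the extra block row \<open>(-I, \<dots>, -I, e)\<close> for the index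
  \<open>k\<close>. In terms of quadratic forms: \<open>Z\<close> at \<open>(f\<^sub>1, \<dots>, f\<^sub>k, t)\<close> equals \<open>Z'\<close> at
  \<open>(f\<^sub>1 - f\<^sub>k, \<dots>, f\<^sub>k\<^sub>-\<^sub>1 - f\<^sub>k, t + e\<^sup>T f\<^sub>k)\<close>.
\<close>

section \<open>Entries of finite sums in the modules of vectors and matrices\<close>

lemma
  fixes v :: "'i \<Rightarrow> 'a::comm_ring_1 vec"
  assumes "finite S" and "\<And>i. i \<in> S \<Longrightarrow> v i \<in> carrier_vec n"
  shows finsum_vec_module_carrier: "(\<Oplus>\<^bsub>module_vec TYPE('a) n\<^esub>i\<in>S. v i) \<in> carrier_vec n"
    and index_finsum_vec_module:
      "a < n \<Longrightarrow> (\<Oplus>\<^bsub>module_vec TYPE('a) n\<^esub>i\<in>S. v i) $ a = (\<Sum>i\<in>S. v i $ a)"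
proof -
  \<comment> \<open>Both notations unfold to the same finite product in the additive monoid of
    vectors, so facts about \<open>finsum_vec\<close> carry over.\<close>
  have eq: "(\<Oplus>\<^bsub>module_vec TYPE('a) n\<^esub>i\<in>S. v i) = finsum_vec TYPE('a) n v S"
    by (simp add: finsum_def finsum_vec_def finprod_def module_vec_def monoid_vec_def)
  show "(\<Oplus>\<^bsub>module_vec TYPE('a) n\<^esub>i\<in>S. v i) \<in> carrier_vec n"
    unfolding eq using assms by (intro finsum_vec_closed) auto
  show "(\<Oplus>\<^bsub>module_vec TYPE('a) n\<^esub>i\<in>S. v i) $ a = (\<Sum>i\<in>S. v i $ a)" if "a < n"
    unfolding eq using assms that by (intro index_finsum_vec) auto
qed

lemma
  fixes A :: "'i \<Rightarrow> 'a::comm_ring_1 mat"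
  assumes "finite S" and "\<And>i. i \<in> S \<Longrightarrow> A i \<in> carrier_mat nr nc"
  shows finsum_mat_module_carrier:
      "(\<Oplus>\<^bsub>module_mat TYPE('a) nr nc\<^esub>i\<in>S. A i) \<in> carrier_mat nr nc"
    and index_finsum_mat_module: "a < nr \<Longrightarrow> b < nc \<Longrightarrow>
      (\<Oplus>\<^bsub>module_mat TYPE('a) nr nc\<^esub>i\<in>S. A i) $$ (a, b) = (\<Sum>i\<in>S. A i $$ (a, b))"
proof -
  interpret M: abelian_group "module_mat TYPE('a) nr nc"
    by (rule abelian_group_mat)
  \<comment> \<open>Ranging over all subsets of \<open>S\<close> provides the carrier fact for each
    partial sum in the induction below.\<close>
  have closed: "(\<Oplus>\<^bsub>module_mat TYPE('a) nr nc\<^esub>i\<in>T. A i) \<in> carrier_mat nr nc" if "T \<subseteq> S" for T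
    using M.finsum_closed[of A T] assms(2) that by (auto simp: module_mat_simps)
  then show "(\<Oplus>\<^bsub>module_mat TYPE('a) nr nc\<^esub>i\<in>S. A i) \<in> carrier_mat nr nc" by blast
  show "(\<Oplus>\<^bsub>module_mat TYPE('a) nr nc\<^esub>i\<in>S. A i) $$ (a, b) = (\<Sum>i\<in>S. A i $$ (a, b))"
    if ab: "a < nr" "b < nc"
  proof -
    have "(\<Oplus>\<^bsub>module_mat TYPE('a) nr nc\<^esub>i\<in>T. A i) $$ (a, b) = (\<Sum>i\<in>T. A i $$ (a, b))"
      if "finite T" "T \<subseteq> S" for T
      using that
    proof (induction T rule: finite_induct)
      case empty
      then show ?case using ab M.finsum_empty[of A] by (simp add: module_mat_simps)
    next
      case (insert i T)
      have "(\<Oplus>\<^bsub>module_mat TYPE('a) nr nc\<^esub>j\<in>insert i T. A j)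
          = A i + (\<Oplus>\<^bsub>module_mat TYPE('a) nr nc\<^esub>j\<in>T. A j)"
        using insert.hyps insert.prems assms(2)
        by (subst M.finsum_insert) (auto simp: module_mat_simps)
      then show ?case
        using insert ab closed[of T] by auto
    qed
    then show ?thesis using assms(1) by blast
  qed
qed

text \<open>The diagonal entries of the product with the all-ones matrix are the column sums of
  \<open>A\<close>, and the trace adds them up.\<close>

lemma trace_inner_ones_mat:
  assumes "A \<in> carrier_mat n n"
  shows "trace_inner (ones_mat n) A = (\<Sum>a<n. \<Sum>b<n. A $$ (a, b))"
proof -
  have "trace_inner (ones_mat n) A = (\<Sum>b<n. \<Sum>a<n. A $$ (a, b))"
    using assms
    by (simp add: trace_inner_def mat_trace_def ones_mat_def outer_prod_def ones_vec_def
        scalar_prod_def lessThan_atLeast0)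
  then show ?thesis by (simp add: sum.swap[of "\<lambda>b a. A $$ (a, b)"])
qed

section \<open>Block coordinates and the quadratic form of a bordered block matrix\<close>

lemma sum_div_mod:
  fixes g :: "nat \<Rightarrow> nat \<Rightarrow> 'a::comm_monoid_add"
  shows "(\<Sum>r<p * n. g (r div n + 1) (r mod n)) = (\<Sum>i=1..p. \<Sum>a<n. g i a)"
proof -
  \<comment> \<open>The range is cut into \<open>p\<close> intervals of length \<open>n\<close>; on
    each the quotient is constant and the remainder is the offset. Blocks are counted from 1, hence
    \<open>Suc i\<close> in the next step.\<close>
  have "(\<Sum>r<p * n. g (r div n + 1) (r mod n))
      = (\<Sum>i<p. \<Sum>r\<in>{i * n..<i * n + n}. g (r div n + 1) (r mod n))"
    by (rule sum.nat_group[symmetric])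
  also have "\<dots> = (\<Sum>i<p. \<Sum>a<n. g (Suc i) a)"
  proof (rule sum.cong[OF refl])
    fix i
    show "(\<Sum>r\<in>{i * n..<i * n + n}. g (r div n + 1) (r mod n)) = (\<Sum>a<n. g (Suc i) a)"
      using sum.shift_bounds_nat_ivl[of "\<lambda>r. g (r div n + 1) (r mod n)" 0 "i * n" n]
      by (auto simp: lessThan_atLeast0 add.commute intro!: sum.cong)
  qed
  also have "\<dots> = (\<Sum>i=1..p. \<Sum>a<n. g i a)"
    by (simp add: sum.atLeast1_atMost_eq)
  finally show ?thesis .
qed

text \<open>Here \<open>f i a\<close> is entry \<open>a\<close> of block \<open>i\<close> of the vector and \<open>t\<close> is its last entry.\<close>

definition bordered_quad_form ::
  "nat \<Rightarrow> nat \<Rightarrow> (nat \<Rightarrow> real vec) \<Rightarrow> (nat \<Rightarrow> nat \<Rightarrow> real mat) \<Rightarrow> (nat \<Rightarrow> nat \<Rightarrow> real) \<Rightarrow> real \<Rightarrow> real"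
where
  "bordered_quad_form p n x B f t =
     (\<Sum>i=1..p. \<Sum>a<n. \<Sum>j=1..p. \<Sum>b<n. f i a * B i j $$ (a, b) * f j b)
     + 2 * t * (\<Sum>i=1..p. \<Sum>a<n. f i a * x i $ a) + t\<^sup>2"

text \<open>Separating the last row and column splits the product into four parts. The two border
  parts coincide since the last row is the transposed last column, whence the factor 2. Only
  agreement of \<open>f\<close> with \<open>v\<close> on block coordinates is assumed, so
  \<open>f\<close> can be read off from \<open>v\<close> or \<open>v\<close> built from
  \<open>f\<close>.\<close>

lemma scalar_prod_bordered_block_mat:
  assumes v: "v \<in> carrier_vec (p * n + 1)"
    and f: "\<And>r. r < p * n \<Longrightarrow> v $ r = f (r div n + 1) (r mod n)" and t: "v $ (p * n) = t"
  shows "v \<bullet> (bordered_block_mat p n x X Y *\<^sub>v v)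
     = bordered_quad_form p n x (\<lambda>i j. if i = j then X i else Y i j) f t"
proof -
  let ?M = "bordered_block_mat p n x X Y" and ?B = "\<lambda>i j. if i = j then X i else Y i j"
  let ?q = "\<lambda>r. r div n + 1" and ?N = "p * n"
  have M: "dim_row ?M = ?N + 1" "dim_col ?M = ?N + 1"
    using bordered_block_mat_carrier[of p n x X Y] by auto
  have Mv: "(?M *\<^sub>v v) $ r = (\<Sum>c<?N. ?M $$ (r, c) * v $ c) + ?M $$ (r, ?N) * v $ ?N"
    if "r < ?N + 1" for r
    using that v M by (simp add: scalar_prod_def lessThan_atLeast0)
  have M11: "?M $$ (r, c) = ?B (?q r) (?q c) $$ (r mod n, c mod n)" if "r < ?N" "c < ?N" for r c
    using that by (simp add: bordered_block_mat_def block_part_def stacked_col_def Let_def)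
  have M12: "?M $$ (r, ?N) = x (?q r) $ (r mod n)" if "r < ?N" for r
    using that by (simp add: bordered_block_mat_def block_part_def stacked_col_def Let_def)
  have M21: "?M $$ (?N, r) = x (?q r) $ (r mod n)" if "r < ?N" for r
    using that by (simp add: bordered_block_mat_def block_part_def stacked_col_def Let_def)
  have M22: "?M $$ (?N, ?N) = 1"
    by (simp add: bordered_block_mat_def block_part_def stacked_col_def Let_def)
  have inner: "(\<Sum>i=1..p. \<Sum>a<n. x i $ a * f i a) = (\<Sum>c<?N. ?M $$ (?N, c) * v $ c)"
    unfolding sum_div_mod[symmetric] using f M21 by (intro sum.cong) auto
  have top: "v $ r * (?M *\<^sub>v v) $ r
      = (\<Sum>j=1..p. \<Sum>b<n. f (?q r) (r mod n) * ?B (?q r) j $$ (r mod n, b) * f j b)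
        + t * (f (?q r) (r mod n) * x (?q r) $ (r mod n))" if r: "r < ?N" for r
  proof -
    have "(\<Sum>j=1..p. \<Sum>b<n. f (?q r) (r mod n) * ?B (?q r) j $$ (r mod n, b) * f j b)
       = (\<Sum>c<?N. v $ r * (?M $$ (r, c) * v $ c))"
      unfolding sum_div_mod[symmetric] using f r M11[OF r] by (intro sum.cong) auto
    then show ?thesis
      using Mv[of r] M12[OF r] f[OF r] r t by (simp add: sum_distrib_left algebra_simps)
  qed
  have "v \<bullet> (?M *\<^sub>v v) = (\<Sum>r<?N. v $ r * (?M *\<^sub>v v) $ r) + v $ ?N * (?M *\<^sub>v v) $ ?N"
    using M by (simp add: scalar_prod_def lessThan_atLeast0)
  also have "(\<Sum>r<?N. v $ r * (?M *\<^sub>v v) $ r) =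
      (\<Sum>i=1..p. \<Sum>a<n. (\<Sum>j=1..p. \<Sum>b<n. f i a * ?B i j $$ (a, b) * f j b) + t * (f i a * x i $ a))"
    (is "_ = (\<Sum>i=1..p. \<Sum>a<n. ?g i a)")
    \<comment> \<open>Fixing \<open>?g\<close> folds only the outer pair of sums into a sum over
      \<open>r\<close>; the inner pair must keep its block form to match \<open>top\<close>.\<close>
    unfolding sum_div_mod[of ?g, symmetric] using top by (intro sum.cong) auto
  also have "v $ ?N * (?M *\<^sub>v v) $ ?N = t * (\<Sum>i=1..p. \<Sum>a<n. x i $ a * f i a) + t\<^sup>2"
    using Mv[of ?N] M22 t inner by (simp add: power2_eq_square algebra_simps)
  finally show ?thesis
    by (simp add: bordered_quad_form_def sum.distrib sum_distrib_left algebra_simps)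
qed

text \<open>The symmetry assumption on the blocks makes the whole matrix symmetric, so only
  nonnegativity of the form is at stake. Vectors then translate to pairs \<open>f\<close>,
  \<open>t\<close> by \<open>form\<close>, and pairs to vectors by \<open>repr\<close>.\<close>

lemma sym_psd_bordered_block_mat_iff:
  assumes n: "0 < n"
    and sym: "\<And>i j a b. \<lbrakk>i \<in> {1..p}; j \<in> {1..p}; a < n; b < n\<rbrakk> \<Longrightarrow>
      (if j = i then X j else Y j i) $$ (b, a) = (if i = j then X i else Y i j) $$ (a, b)"
  shows "sym_psd (bordered_block_mat p n x X Y) \<longleftrightarrow>
     (\<forall>f t. 0 \<le> bordered_quad_form p n x (\<lambda>i j. if i = j then X i else Y i j) f t)"
    (is "_ \<longleftrightarrow> (\<forall>f t. 0 \<le> ?Q f t)")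
proof -
  let ?M = "bordered_block_mat p n x X Y"
  have M: "dim_row ?M = p * n + 1" "dim_col ?M = p * n + 1"
    using bordered_block_mat_carrier[of p n x X Y] by auto
  have div_less: "r div n < p" if "r < p * n" for r
    using that by (simp add: less_mult_imp_div_less)
  have "transpose_mat (block_part p n X Y) = block_part p n X Y"
  proof (rule eq_matI)
    fix r c assume "r < dim_row (block_part p n X Y)" "c < dim_col (block_part p n X Y)"
    then have rc: "r < p * n" "c < p * n" by (simp_all add: block_part_def)
    then show "transpose_mat (block_part p n X Y) $$ (r, c) = block_part p n X Y $$ (r, c)"
      using sym[of "r div n + 1" "c div n + 1" "r mod n" "c mod n"] div_less n
      by (auto simp: block_part_def Let_def Suc_le_eq)
  qed (simp_all add: block_part_def)
  then have trans: "transpose_mat ?M = ?M"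
    unfolding bordered_block_mat_def
    by (subst transpose_four_block_mat[where ?nr1.0="p * n" and ?nc1.0="p * n"
          and ?nr2.0=1 and ?nc2.0=1]) (auto simp: block_part_def stacked_col_def)
  \<comment> \<open>Block \<open>i\<close> starts at position \<open>(i - 1) * n\<close> because
    blocks are counted from 1 and vector entries from 0.\<close>
  have form: "v \<bullet> (?M *\<^sub>v v) = ?Q (\<lambda>i a. v $ ((i - 1) * n + a)) (v $ (p * n))"
    if "v \<in> carrier_vec (p * n + 1)" for v
    using that by (intro scalar_prod_bordered_block_mat) auto
  have repr: "?Q f t = (let v = vec (p * n + 1) (\<lambda>r. if r < p * n then f (r div n + 1) (r mod n) else t)
      in v \<bullet> (?M *\<^sub>v v))" for f t
    unfolding Let_def by (intro scalar_prod_bordered_block_mat[symmetric]) auto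
  show ?thesis
  proof
    assume "sym_psd ?M"
    then show "\<forall>f t. 0 \<le> ?Q f t"
      unfolding sym_psd_def M repr Let_def by auto
  next
    assume "\<forall>f t. 0 \<le> ?Q f t"
    then show "sym_psd ?M"
      unfolding sym_psd_def using form trans M by (auto simp: square_mat.simps)
  qed
qed

section \<open>The congruence as an identity between quadratic forms\<close>

lemma bordered_quad_form_Suc:
  assumes sym: "\<And>i j a b. \<lbrakk>i \<in> {1..p}; j \<in> {1..p}; a < n; b < n\<rbrakk> \<Longrightarrow> B j i $$ (b, a) = B i j $$ (a, b)"
    and last_col: "\<And>i a b. \<lbrakk>i \<in> {1..p}; a < n; b < n\<rbrakk> \<Longrightarrow>
      B i (Suc p) $$ (a, b) = x i $ a - (\<Sum>j=1..p. B i j $$ (a, b))"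
    and last_row: "\<And>i a b. \<lbrakk>i \<in> {1..p}; a < n; b < n\<rbrakk> \<Longrightarrow> B (Suc p) i $$ (b, a) = B i (Suc p) $$ (a, b)"
    and corner: "\<And>a b. \<lbrakk>a < n; b < n\<rbrakk> \<Longrightarrow>
      B (Suc p) (Suc p) $$ (a, b) = x (Suc p) $ a - (\<Sum>j=1..p. B (Suc p) j $$ (a, b))"
    and last_x: "\<And>a. a < n \<Longrightarrow> x (Suc p) $ a = 1 - (\<Sum>i=1..p. x i $ a)"
  shows "bordered_quad_form (Suc p) n x B f t =
    bordered_quad_form p n x B (\<lambda>i a. f i a - f (Suc p) a) (t + (\<Sum>a<n. f (Suc p) a))"
proof -
  \<comment> \<open>The target argument is \<open>f - w\<close> with last entry
    \<open>t + U\<close>: \<open>w\<close> repeats the last block \<open>u\<close> in each of the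
    \<open>p\<close> blocks, and \<open>U\<close> is its entry sum. The contributions of the last
    block are now expressed through \<open>bil\<close>, \<open>lin\<close> and
    \<open>U\<close>.\<close>
  define u where "u = f (Suc p)"
  define U where "U = (\<Sum>a<n. u a)"
  define bil where "bil g h = (\<Sum>i=1..p. \<Sum>a<n. \<Sum>j=1..p. \<Sum>b<n. g i a * B i j $$ (a, b) * h j b)"
    for g h :: "nat \<Rightarrow> nat \<Rightarrow> real"
  define lin where "lin g = (\<Sum>i=1..p. \<Sum>a<n. g i a * x i $ a)" for g :: "nat \<Rightarrow> nat \<Rightarrow> real"
  define w where "w = (\<lambda>_::nat. u)"

  have bil_commute: "bil g h = bil h g" for g h
  proof -
    have "bil g h = (\<Sum>i=1..p. \<Sum>j=1..p. \<Sum>a<n. \<Sum>b<n. g i a * B i j $$ (a, b) * h j b)"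
      unfolding bil_def by (intro sum.cong[OF refl] sum.swap)
    also have "\<dots> = (\<Sum>j=1..p. \<Sum>i=1..p. \<Sum>b<n. \<Sum>a<n. g i a * B i j $$ (a, b) * h j b)"
      by (subst sum.swap) (intro sum.cong[OF refl] sum.swap)
    also have "\<dots> = (\<Sum>j=1..p. \<Sum>i=1..p. \<Sum>b<n. \<Sum>a<n. h j b * B j i $$ (b, a) * g i a)"
      by (intro sum.cong[OF refl]) (simp add: sym)
    also have "\<dots> = bil h g"
      unfolding bil_def by (intro sum.cong[OF refl] sum.swap)
    finally show ?thesis .
  qed

  \<comment> \<open>In \<open>last_col\<close> the term \<open>x i\<close> pairs with
    \<open>u\<close> to give the factor \<open>U\<close>, while the sum over \<open>j\<close> pairs
    every block with the same \<open>u\<close>, that is, with \<open>w\<close>.\<close>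
  have col: "(\<Sum>i=1..p. \<Sum>a<n. \<Sum>b<n. h i a * B i (Suc p) $$ (a, b) * u b) = lin h * U - bil h w" for h
  proof -
    have "(\<Sum>b<n. h i a * B i (Suc p) $$ (a, b) * u b)
        = h i a * x i $ a * U - (\<Sum>j=1..p. \<Sum>b<n. h i a * B i j $$ (a, b) * w j b)"
      if "i \<in> {1..p}" "a < n" for i a
    proof -
      have "(\<Sum>b<n. h i a * B i (Suc p) $$ (a, b) * u b)
          = (\<Sum>b<n. h i a * x i $ a * u b - (\<Sum>j=1..p. h i a * B i j $$ (a, b) * u b))"
        using that
        by (intro sum.cong[OF refl])
           (simp add: last_col left_diff_distrib right_diff_distrib sum_distrib_left sum_distrib_right)
      then show ?thesis
        by (simp add: U_def w_def sum_subtractf sum_distrib_left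
            sum.swap[of "\<lambda>b j. h i a * B i j $$ (a, b) * u b"])
    qed
    then show ?thesis
      by (simp add: lin_def bil_def sum_subtractf sum_distrib_right)
  qed

  \<comment> \<open>The last block row is the transpose of the last block column, so it contributes
    the same amount as in \<open>col\<close>.\<close>
  have row: "(\<Sum>a<n. \<Sum>j=1..p. \<Sum>b<n. u a * B (Suc p) j $$ (a, b) * h j b) = lin h * U - bil h w" for h
  proof -
    have "(\<Sum>a<n. \<Sum>j=1..p. \<Sum>b<n. u a * B (Suc p) j $$ (a, b) * h j b)
        = (\<Sum>j=1..p. \<Sum>a<n. \<Sum>b<n. u a * B (Suc p) j $$ (a, b) * h j b)"
      by (rule sum.swap)
    also have "\<dots> = (\<Sum>j=1..p. \<Sum>b<n. \<Sum>a<n. u a * B (Suc p) j $$ (a, b) * h j b)"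
      by (intro sum.cong[OF refl] sum.swap)
    also have "\<dots> = (\<Sum>j=1..p. \<Sum>b<n. \<Sum>a<n. h j b * B j (Suc p) $$ (b, a) * u a)"
      by (intro sum.cong[OF refl]) (simp add: last_row)
    finally show ?thesis using col by simp
  qed

  have border: "(\<Sum>a<n. u a * x (Suc p) $ a) = U - lin w"
  proof -
    have "(\<Sum>a<n. u a * x (Suc p) $ a) = (\<Sum>a<n. u a - (\<Sum>i=1..p. u a * x i $ a))"
      by (intro sum.cong[OF refl]) (simp add: last_x algebra_simps sum_distrib_left)
    then show ?thesis
      by (simp add: U_def lin_def w_def sum_subtractf sum.swap[of "\<lambda>a i. u a * x i $ a"])
  qed

  \<comment> \<open>Expanding the corner along its row relation leaves \<open>border\<close> times
    \<open>U\<close> minus the last row paired with \<open>w\<close>, which is \<open>row\<close> at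
    \<open>h = w\<close>.\<close>
  have corner_sum: "(\<Sum>a<n. \<Sum>b<n. u a * B (Suc p) (Suc p) $$ (a, b) * u b) = (U - lin w) * U - (lin w * U - bil w w)"
  proof -
    have "(\<Sum>b<n. u a * B (Suc p) (Suc p) $$ (a, b) * u b)
       = u a * x (Suc p) $ a * U - (\<Sum>j=1..p. \<Sum>b<n. u a * B (Suc p) j $$ (a, b) * w j b)"
      if "a < n" for a
    proof -
      have "(\<Sum>b<n. u a * B (Suc p) (Suc p) $$ (a, b) * u b)
          = (\<Sum>b<n. u a * x (Suc p) $ a * u b - (\<Sum>j=1..p. u a * B (Suc p) j $$ (a, b) * u b))"
        using that
        by (intro sum.cong[OF refl])
           (simp add: corner left_diff_distrib right_diff_distrib sum_distrib_left sum_distrib_right)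
      then show ?thesis
        by (simp add: U_def w_def sum_subtractf sum_distrib_left
            sum.swap[of "\<lambda>b j. u a * B (Suc p) j $$ (a, b) * u b"])
    qed
    then have "(\<Sum>a<n. \<Sum>b<n. u a * B (Suc p) (Suc p) $$ (a, b) * u b)
       = (\<Sum>a<n. u a * x (Suc p) $ a) * U - (\<Sum>a<n. \<Sum>j=1..p. \<Sum>b<n. u a * B (Suc p) j $$ (a, b) * w j b)"
      by (simp add: sum_subtractf sum_distrib_right)
    then show ?thesis by (simp only: border row)
  qed

  have "bordered_quad_form (Suc p) n x B f t
      = bil f f + (lin f * U - bil f w) + (lin f * U - bil f w)
        + ((U - lin w) * U - (lin w * U - bil w w)) + 2 * t * (lin f + (U - lin w)) + t\<^sup>2"
    unfolding bordered_quad_form_def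
    using col[of f, symmetric] row[of f, symmetric] corner_sum[symmetric] border[symmetric]
    by (simp add: sum.distrib bil_def lin_def u_def)
  \<comment> \<open>The terms \<open>2 * t * U\<close> and the square of \<open>U\<close> complete
    the square of \<open>t + U\<close>; symmetry of \<open>bil\<close> splits the doubled cross
    term.\<close>
  also have "\<dots> = (bil f f - bil f w - bil w f + bil w w)
      + 2 * (t + U) * (lin f - lin w) + (t + U)\<^sup>2"
    by (simp add: bil_commute[of w f] algebra_simps power2_eq_square)
  also have "bil f f - bil f w - bil w f + bil w w = bil (\<lambda>i a. f i a - u a) (\<lambda>i a. f i a - u a)"
    by (simp add: bil_def w_def algebra_simps sum.distrib sum_subtractf)
  also have "lin f - lin w = lin (\<lambda>i a. f i a - u a)"
    by (simp add: lin_def w_def algebra_simps sum_subtractf)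
  finally show ?thesis
    by (simp add: bordered_quad_form_def bil_def lin_def u_def U_def)
qed

theorem lemma7:
  fixes n k :: nat
    and m :: "nat \<Rightarrow> nat"
    and x :: "nat \<Rightarrow> real vec"
    and X :: "nat \<Rightarrow> real mat"
    and Y :: "nat \<Rightarrow> nat \<Rightarrow> real mat"
  assumes "3 \<le> k" and "k \<le> n"
    and "\<forall>i\<in>{1..k}. 1 \<le> m i"
    and "(\<Sum>i=1..k. m i) = n"
    and "\<forall>i\<in>{1..k-1}. x i \<in> carrier_vec n"
    and "\<forall>i\<in>{1..k-1}. X i \<in> carrier_mat n n \<and> transpose_mat (X i) = X i"
    and "\<forall>i\<in>{1..k-1}. \<forall>j\<in>{1..k-1}. i \<noteq> j \<longrightarrow>
           Y i j \<in> carrier_mat n n \<and> Y j i = transpose_mat (Y i j)"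
    and "\<forall>i\<in>{1..k-1}. diag_vec (X i) = x i"
    and "\<forall>i\<in>{1..k-1}. \<forall>j\<in>{1..k-1}. i \<noteq> j \<longrightarrow> diag_vec (Y i j) = 0\<^sub>v n"
    and "\<forall>i\<in>{1..k-1}. mat_trace (X i) = real (m i)"
    and "\<forall>i\<in>{1..k-1}. trace_inner (ones_mat n) (X i) = (real (m i))\<^sup>2"
    and "\<forall>i\<in>{1..k-1}. \<forall>j\<in>{1..k-1}. i \<noteq> j \<longrightarrow>
           trace_inner (ones_mat n) (Y i j + transpose_mat (Y i j)) = 2 * real (m i) * real (m j)"
    and "sym_psd (bordered_block_mat (k-1) n x X Y)"
    and def_x_k: "x k = ones_vec n - (\<Oplus>\<^bsub>module_vec TYPE(real) n\<^esub>i\<in>{1..k-1}. x i)"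
    and def_Y_ik: "\<forall>i\<in>{1..k-1}. Y i k =
           outer_prod (x i) (ones_vec n) - X i
             - (\<Oplus>\<^bsub>module_mat TYPE(real) n n\<^esub>j\<in>{1..k-1} - {i}. Y i j)"
    and def_Y_ki: "\<forall>i\<in>{1..k-1}. Y k i = transpose_mat (Y i k)"
    and def_X_k: "X k = outer_prod (x k) (ones_vec n)
             - (\<Oplus>\<^bsub>module_mat TYPE(real) n n\<^esub>j\<in>{1..k-1}. Y k j)"
  shows "(\<forall>i\<in>{1..k}. diag_vec (X i) = x i) \<and>
    (\<forall>i\<in>{1..k}. \<forall>j\<in>{1..k}. i \<noteq> j \<longrightarrow> diag_vec (Y i j) = 0\<^sub>v n) \<and>
    (\<forall>i\<in>{1..k}. mat_trace (X i) = real (m i)) \<and>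
    (\<forall>i\<in>{1..k}. trace_inner (ones_mat n) (X i) = (real (m i))\<^sup>2) \<and>
    (\<forall>i\<in>{1..k}. \<forall>j\<in>{1..k}. i \<noteq> j \<longrightarrow>
       trace_inner (ones_mat n) (Y i j + transpose_mat (Y i j)) = 2 * real (m i) * real (m j)) \<and>
    sym_psd (bordered_block_mat k n x X Y)"
proof -

  \<comment> \<open>Notation and the given blocks\<close>
  define p where "p = k - 1"
  have k: "k = Suc p" and n0: "0 < n" using assms(1,2) by (auto simp: p_def)
  have pk: "k - 1 = p" by (simp add: p_def)
  note A = assms[unfolded pk]
  \<comment> \<open>Merging both families turns the row relation into a single sum over all
    \<open>j\<close>, with the diagonal block as the term \<open>j = i\<close>.\<close>
  define B where "B = (\<lambda>i j. if i = j then X i else Y i j)"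
  have k_notin: "k \<notin> {1..p}" and range_k: "{1..k} = insert k {1..p}" by (auto simp: k)
  have sum_k: "(\<Sum>i=1..k. g i) = g k + (\<Sum>i=1..p. g i)" for g :: "nat \<Rightarrow> real"
    by (simp add: k)
  have m_k: "real (m k) = real n - (\<Sum>i=1..p. real (m i))"
    using A(4) sum_k[of "\<lambda>i. real (m i)"] by (simp flip: of_nat_sum)

  have x_carrier: "x i \<in> carrier_vec n" if "i \<in> {1..p}" for i using A(5) that by blast
  have Y_carrier: "Y i j \<in> carrier_mat n n" if "i \<in> {1..p}" "j \<in> {1..p}" "i \<noteq> j" for i j
    using A(7) that by blast
  have B_carrier: "B i j \<in> carrier_mat n n" if "i \<in> {1..p}" "j \<in> {1..p}" for i j
    using A(6) Y_carrier that by (simp add: B_def)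
  have B_sym: "B j i = transpose_mat (B i j)" if "i \<in> {1..p}" "j \<in> {1..p}" for i j
    using A(6,7) that unfolding B_def by metis
  have B_diag: "B i j $$ (a, a) = (if i = j then x i $ a else 0)"
    if "i \<in> {1..p}" "j \<in> {1..p}" "a < n" for i j a
  proof -
    have "B i j $$ (a, a) = diag_vec (B i j) $ a"
      using B_carrier[OF that(1,2)] that(3) by (auto simp: diag_vec_def)
    also have "\<dots> = (if i = j then x i $ a else 0)"
      using A(8,9) that by (auto simp: B_def)
    finally show ?thesis .
  qed

  \<comment> \<open>Entries and symmetry of the completed blocks\<close>
  have x_k_carrier: "x k \<in> carrier_vec n"
    unfolding def_x_k pk ones_vec_def using finsum_vec_module_carrier[of "{1..p}" x n] x_carrier by auto
  have x_k: "x k $ a = 1 - (\<Sum>i=1..p. x i $ a)" if "a < n" for a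
    unfolding def_x_k pk ones_vec_def
    using finsum_vec_module_carrier[of "{1..p}" x n] index_finsum_vec_module[of "{1..p}" x n a] x_carrier that by auto

  have Y_sums: "(\<Oplus>\<^bsub>module_mat TYPE(real) n n\<^esub>j\<in>{1..p} - {i}. Y i j) \<in> carrier_mat n n"
    "\<And>a b. \<lbrakk>a < n; b < n\<rbrakk> \<Longrightarrow> (\<Oplus>\<^bsub>module_mat TYPE(real) n n\<^esub>j\<in>{1..p} - {i}. Y i j) $$ (a, b)
      = (\<Sum>j\<in>{1..p} - {i}. Y i j $$ (a, b))" if "i \<in> {1..p}" for i
    by (rule finsum_mat_module_carrier index_finsum_mat_module; use Y_carrier that in force)+
  have Y_ik_carrier: "Y i k \<in> carrier_mat n n" if "i \<in> {1..p}" for i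
    using def_Y_ik[unfolded pk] that Y_sums(1)[OF that] by auto
  have Y_ik: "Y i k $$ (a, b) = x i $ a - (\<Sum>j=1..p. B i j $$ (a, b))"
    if "i \<in> {1..p}" "a < n" "b < n" for i a b
  proof -
    have "(\<Sum>j=1..p. B i j $$ (a, b)) = X i $$ (a, b) + (\<Sum>j\<in>{1..p} - {i}. Y i j $$ (a, b))"
      using that(1) by (subst sum.remove[of _ i]) (auto simp: B_def intro!: sum.cong)
    moreover have "X i \<in> carrier_mat n n" "x i \<in> carrier_vec n" using A(5,6) that by auto
    ultimately show ?thesis
      using def_Y_ik[unfolded pk] that Y_sums[OF that(1)] by (auto simp: outer_prod_def ones_vec_def)
  qed
  have Y_ki: "Y k i = transpose_mat (Y i k)" if "i \<in> {1..p}" for i using def_Y_ki[unfolded pk] that by simp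
  have Y_ki_carrier: "Y k i \<in> carrier_mat n n" if "i \<in> {1..p}" for i
    using Y_ki[OF that] Y_ik_carrier[OF that] by simp
  have Y_k_sums: "(\<Oplus>\<^bsub>module_mat TYPE(real) n n\<^esub>j\<in>{1..p}. Y k j) \<in> carrier_mat n n"
    "\<And>a b. \<lbrakk>a < n; b < n\<rbrakk> \<Longrightarrow> (\<Oplus>\<^bsub>module_mat TYPE(real) n n\<^esub>j\<in>{1..p}. Y k j) $$ (a, b)
      = (\<Sum>j\<in>{1..p}. Y k j $$ (a, b))"
    using Y_ki_carrier by (auto intro!: finsum_mat_module_carrier index_finsum_mat_module)
  have X_k_carrier: "X k \<in> carrier_mat n n"
    unfolding def_X_k pk using Y_k_sums(1) by auto
  have X_k: "X k $$ (a, b) = x k $ a - (\<Sum>j=1..p. Y k j $$ (a, b))" if "a < n" "b < n" for a b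
    unfolding def_X_k pk using Y_k_sums that x_k_carrier by (auto simp: outer_prod_def ones_vec_def)
  have Y_ki_entry: "Y k i $$ (b, a) = Y i k $$ (a, b)" if "i \<in> {1..p}" "a < n" "b < n" for i a b
    using Y_ki[OF that(1)] Y_ik_carrier[OF that(1)] that by auto
  have B_sym_entry: "B j i $$ (b, a) = B i j $$ (a, b)"
    if "i \<in> {1..p}" "j \<in> {1..p}" "a < n" "b < n" for i j a b
    using B_sym[OF that(1,2)] B_carrier[OF that(1,2)] that by auto

  have X_k_sym: "X k $$ (b, a) = X k $$ (a, b)" if "a < n" "b < n" for a b
  proof -
    \<comment> \<open>Inserting the definitions of \<open>Y k j\<close> and \<open>x k\<close> gives
      a formula whose linear terms are exchanged by swapping \<open>a\<close> and \<open>b\<close>;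
      the double sum is invariant by symmetry of \<open>B\<close>.\<close>
    have *: "X k $$ (a, b) = 1 - (\<Sum>i=1..p. x i $ a) - (\<Sum>i=1..p. x i $ b) + (\<Sum>j=1..p. \<Sum>i=1..p. B j i $$ (b, a))"
      if "a < n" "b < n" for a b
      using that by (simp add: X_k x_k Y_ki_entry[where a=b and b=a] Y_ik sum_subtractf)
    have "(\<Sum>j=1..p. \<Sum>i=1..p. B j i $$ (b, a)) = (\<Sum>i=1..p. \<Sum>j=1..p. B i j $$ (a, b))"
      by (subst sum.swap) (intro sum.cong[OF refl] B_sym_entry, use that in auto)
    then show ?thesis using *[OF that] *[OF that(2,1)] by simp
  qed

  \<comment> \<open>Diagonals and traces\<close>
  have Y_ik_diag: "Y i k $$ (a, a) = 0" if "i \<in> {1..p}" "a < n" for i a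
    \<comment> \<open>On the diagonal only the term \<open>j = i\<close> survives, and it equals
      \<open>x i $ a\<close>, so the difference vanishes.\<close>
    using that by (simp add: Y_ik B_diag sum.delta')
  have X_k_diag: "X k $$ (a, a) = x k $ a" if "a < n" for a
    using that by (simp add: X_k Y_ki_entry Y_ik_diag)

  have diag_X: "diag_vec (X i) = x i" if "i \<in> {1..k}" for i
  proof (cases "i = k")
    case True
    show ?thesis
      unfolding True using X_k_carrier x_k_carrier X_k_diag
      by (intro eq_vecI) (auto simp: diag_vec_def)
  qed (use A(8) that range_k in auto)

  have diag_Y: "diag_vec (Y i j) = 0\<^sub>v n" if "i \<in> {1..k}" "j \<in> {1..k}" "i \<noteq> j" for i j
  proof -
    have "diag_vec (Y i k) = 0\<^sub>v n" "diag_vec (Y k i) = 0\<^sub>v n" if "i \<in> {1..p}" for i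
      using Y_ik_carrier[OF that] Y_ki_carrier[OF that] Y_ik_diag[OF that] Y_ki_entry[OF that]
      by (auto intro!: eq_vecI simp: diag_vec_def)
    then show ?thesis using A(9) that unfolding range_k by blast
  qed

  have trace_X: "mat_trace (X i) = real (m i)" if "i \<in> {1..k}" for i
  proof (cases "i = k")
    case True
    \<comment> \<open>The given traces are the entry sums of the \<open>x i\<close>; subtracting
      them from \<open>n\<close> leaves \<open>m k\<close>.\<close>
    have "(\<Sum>a<n. x i $ a) = real (m i)" if i: "i \<in> {1..p}" for i
    proof -
      have "(\<Sum>a<n. x i $ a) = mat_trace (X i)"
        using B_carrier[OF i i] B_diag[OF i i] by (auto simp: mat_trace_def B_def)
      then show ?thesis using A(10) i by simp
    qed
    then have "(\<Sum>a<n. x k $ a) = real (m k)"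
      by (simp add: x_k m_k sum_subtractf sum.swap[of "\<lambda>a i. x i $ a"])
    then show ?thesis
      unfolding True using X_k_carrier X_k_diag by (auto simp: mat_trace_def)
  qed (use A(10) that range_k in auto)

  \<comment> \<open>Inner products with the all-ones matrix, computed as entry sums\<close>
  define tot where "tot M = (\<Sum>a<n. \<Sum>b<n. M $$ (a, b))" for M :: "real mat"
  have sum_swap3: "(\<Sum>a<n. \<Sum>b<n. \<Sum>j=1..p. g a b j) = (\<Sum>j=1..p. \<Sum>a<n. \<Sum>b<n. g a b j)"
    for g :: "nat \<Rightarrow> nat \<Rightarrow> nat \<Rightarrow> real"
  proof -
    have "(\<Sum>a<n. \<Sum>b<n. \<Sum>j=1..p. g a b j) = (\<Sum>a<n. \<Sum>j=1..p. \<Sum>b<n. g a b j)"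
      by (intro sum.cong[OF refl] sum.swap)
    also have "\<dots> = (\<Sum>j=1..p. \<Sum>a<n. \<Sum>b<n. g a b j)"
      by (rule sum.swap)
    finally show ?thesis .
  qed
  have inner: "trace_inner (ones_mat n) M = tot M" if "M \<in> carrier_mat n n" for M
    using trace_inner_ones_mat[OF that] by (simp add: tot_def)
  have tot_transpose: "tot (transpose_mat M) = tot M" if "M \<in> carrier_mat n n" for M
    using that by (simp add: tot_def sum.swap[of "\<lambda>a b. M $$ (b, a)"])
  have tot_add: "tot (M + transpose_mat M) = 2 * tot M" if "M \<in> carrier_mat n n" for M
  proof -
    have "tot (M + transpose_mat M) = tot M + tot (transpose_mat M)"
      using that by (auto simp: tot_def sum.distrib)
    then show ?thesis by (simp add: tot_transpose that)
  qed
  have tot_B: "tot (B i j) = real (m i) * real (m j)" if "i \<in> {1..p}" "j \<in> {1..p}" for i j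
  proof (cases "i = j")
    case True
    then show ?thesis using A(11) B_carrier[OF that] that inner[of "X i"]
      by (auto simp: B_def power2_eq_square)
  next
    case False
    \<comment> \<open>The hypothesis concerns the symmetrised block; transposition preserves the
      entry sum, so it determines twice the value for \<open>Y i j\<close>.\<close>
    then have "2 * tot (Y i j) = 2 * real (m i) * real (m j)"
      using A(12) that Y_carrier[OF that] inner[of "Y i j + transpose_mat (Y i j)"] tot_add[of "Y i j"] by auto
    then show ?thesis using False by (simp add: B_def)
  qed
  have x_sum: "(\<Sum>a<n. x i $ a) = real (m i)" if "i \<in> {1..k}" for i
  proof -
    have c: "X i \<in> carrier_mat n n" using that X_k_carrier A(6) unfolding range_k by auto
    have "x i $ a = X i $$ (a, a)" if "a < n" for a
      using diag_X[OF \<open>i \<in> {1..k}\<close>, symmetric] c that by (simp add: diag_vec_def)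
    then show ?thesis using trace_X[OF that] c by (simp add: mat_trace_def)
  qed
  \<comment> \<open>Summing the row relation gives \<open>m i\<close> times \<open>n\<close> minus
    the sum of the first \<open>p\<close> sizes, and that difference is \<open>m k\<close>.\<close>
  have tot_Y_ik: "tot (Y i k) = real (m i) * real (m k)" if i: "i \<in> {1..p}" for i
  proof -
    have "tot (Y i k) = (\<Sum>a<n. \<Sum>b<n. x i $ a) - (\<Sum>a<n. \<Sum>b<n. \<Sum>j=1..p. B i j $$ (a, b))"
      using i by (simp add: tot_def Y_ik sum_subtractf)
    also have "(\<Sum>a<n. \<Sum>b<n. \<Sum>j=1..p. B i j $$ (a, b)) = (\<Sum>j=1..p. tot (B i j))"
      unfolding tot_def by (rule sum_swap3)
    also have "\<dots> = real (m i) * (\<Sum>j=1..p. real (m j))"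
      using i by (simp add: tot_B sum_distrib_left)
    also have "(\<Sum>a<n. \<Sum>b<n. x i $ a) = real (m i) * real n"
      using i x_sum[of i] by (simp add: k mult.commute flip: sum_distrib_left)
    finally show ?thesis by (simp add: m_k algebra_simps)
  qed
  have tot_Y_ki: "tot (Y k i) = real (m i) * real (m k)" if "i \<in> {1..p}" for i
    using that by (simp add: Y_ki tot_transpose Y_ik_carrier tot_Y_ik)
  \<comment> \<open>The same count along block row \<open>k\<close>, now using the entry sums of the
    blocks \<open>Y k j\<close> just found.\<close>
  have tot_X_k: "tot (X k) = (real (m k))\<^sup>2"
  proof -
    have "tot (X k) = (\<Sum>a<n. \<Sum>b<n. x k $ a) - (\<Sum>a<n. \<Sum>b<n. \<Sum>j=1..p. Y k j $$ (a, b))"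
      by (simp add: tot_def X_k sum_subtractf)
    also have "(\<Sum>a<n. \<Sum>b<n. \<Sum>j=1..p. Y k j $$ (a, b)) = (\<Sum>j=1..p. tot (Y k j))"
      unfolding tot_def by (rule sum_swap3)
    also have "\<dots> = (\<Sum>j=1..p. real (m j)) * real (m k)"
      by (simp add: tot_Y_ki sum_distrib_right)
    also have "(\<Sum>a<n. \<Sum>b<n. x k $ a) = real (m k) * real n"
      using x_sum[of k] by (simp add: k mult.commute flip: sum_distrib_left)
    finally show ?thesis by (simp add: m_k algebra_simps power2_eq_square)
  qed

  have inner_X: "trace_inner (ones_mat n) (X i) = (real (m i))\<^sup>2" if "i \<in> {1..k}" for i
    using that A(11) tot_X_k inner[OF X_k_carrier] unfolding range_k by auto
  have inner_Y: "trace_inner (ones_mat n) (Y i j + transpose_mat (Y i j)) = 2 * real (m i) * real (m j)"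
    if "i \<in> {1..k}" "j \<in> {1..k}" "i \<noteq> j" for i j
  proof -
    have "trace_inner (ones_mat n) (Y i k + transpose_mat (Y i k)) = 2 * real (m i) * real (m k)"
      "trace_inner (ones_mat n) (Y k i + transpose_mat (Y k i)) = 2 * real (m k) * real (m i)"
      if "i \<in> {1..p}" for i
      using that Y_ik_carrier[OF that] Y_ki_carrier[OF that] tot_add[of "Y i k"] tot_add[of "Y k i"]
      by (simp_all add: inner tot_Y_ik tot_Y_ki)
    then show ?thesis using A(12) that unfolding range_k by blast
  qed

  \<comment> \<open>Positive semidefiniteness of the full matrix\<close>
  have sym_k: "B j i $$ (b, a) = B i j $$ (a, b)"
    if "i \<in> {1..k}" "j \<in> {1..k}" "a < n" "b < n" for i j a b
    using that B_sym_entry[of i j a b] Y_ki_entry[of i a b] Y_ki_entry[of j b a] X_k_sym[of a b] k_notin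
    unfolding range_k by (auto simp: B_def)
  have "bordered_quad_form k n x B f t =
    bordered_quad_form p n x B (\<lambda>i a. f i a - f k a) (t + (\<Sum>a<n. f k a))" for f t
    unfolding k
  proof (rule bordered_quad_form_Suc, unfold k[symmetric])
    show "B j i $$ (b, a) = B i j $$ (a, b)" if "i \<in> {1..p}" "j \<in> {1..p}" "a < n" "b < n" for i j a b
      using that by (rule B_sym_entry)
    show "B i k $$ (a, b) = x i $ a - (\<Sum>j=1..p. B i j $$ (a, b))"
      if "i \<in> {1..p}" "a < n" "b < n" for i a b
      using Y_ik[OF that] that(1) k_notin by (auto simp: B_def)
    show "B k i $$ (b, a) = B i k $$ (a, b)" if "i \<in> {1..p}" "a < n" "b < n" for i a b
      using that range_k by (intro sym_k) auto
    have "(\<Sum>j=1..p. B k j $$ (a, b)) = (\<Sum>j=1..p. Y k j $$ (a, b))" for a b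
      using k_notin by (intro sum.cong[OF refl]) (auto simp: B_def)
    then show "B k k $$ (a, b) = x k $ a - (\<Sum>j=1..p. B k j $$ (a, b))" if "a < n" "b < n" for a b
      using X_k[OF that] by (simp add: B_def)
  qed (rule x_k)
  \<comment> \<open>The reduced form is nonnegative at every argument, in particular at the
    substituted one.\<close>
  moreover have "0 \<le> bordered_quad_form p n x B f t" for f t
    using A(13) B_sym_entry sym_psd_bordered_block_mat_iff[OF n0, of p X Y x]
    unfolding B_def by blast
  ultimately have "sym_psd (bordered_block_mat k n x X Y)"
    using sym_k sym_psd_bordered_block_mat_iff[OF n0, of k X Y x]
    unfolding B_def by simp
  then show ?thesis
    using diag_X diag_Y trace_X inner_X inner_Y by blast
qed

end
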